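(* Let $X_1,\dots,X_n$ be independent random variables with $\mathsf E X_k=0$, $\sigma_k^2=\mathsf E X_k^2<\infty$, $S_n=\sum_{k=1}^nX_k$, $B_n^2=\sum_{k=1}^n\sigma_k^2>0$. Put $$\Delta_n=\sup_{x\in\mathbb R}|\mathsf P(S_n<xB_n)-\Phi(x)|,$$ $$L_n(1)=\frac1{B_n^2}\sum_{k=1}^n\mathsf E X_k^2\mathbf 1(|X_k|>B_n),\qquad M_n(1)=\frac1{B_n^3}\sum_{k=1}^n\mathsf E|X_k|^3\mathbf 1(|X_k|\le B_n).$$ Then $$\Delta_n\le C\,(L_n(1)+M_n(1)),$$ where $$C=\inf_{0<b<1}\max\Big\{\frac2{1-b^2},\ 1+\frac{4.25\,C_0}{b^3}+\frac1{\sqrt{2\pi}\,b}\Big(1+\frac{2e^{-1/2}}{1+b}\Big)\Big\}$$ and $C_0$ is the absolute constant in the classical Berry–Esseen inequality (with third moments).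
   Context: $\Phi$ is the standard normal distribution function. The classical Berry–Esseen inequality with absolute constant $C_0$: for all $n$ and all independent $Y_1,\dots,Y_n$ with $\mathsf E Y_k=0$, $\mathsf E|Y_k|^3<\infty$ and $b_n^2=\sum_k\mathsf E Y_k^2>0$, one has $\sup_x|\mathsf P(Y_1+\dots+Y_n<xb_n)-\Phi(x)|\le C_0\,b_n^{-3}\sum_k\mathsf E|Y_k|^3$. *)

theory Defs
  imports "HOL-Probability.Probability"
begin

definition std_normal_cdf :: "real \<Rightarrow> real" where
  "std_normal_cdf = cdf std_normal_distribution"

definition partial_sum :: "(nat \<Rightarrow> 'a \<Rightarrow> real) \<Rightarrow> nat \<Rightarrow> 'a \<Rightarrow> real" where
  "partial_sum X n \<omega> = (\<Sum>k=1..n. X k \<omega>)"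

(* For the centred summands considered here this is the standard deviation of the sum. *)
definition sum_sd :: "'a measure \<Rightarrow> (nat \<Rightarrow> 'a \<Rightarrow> real) \<Rightarrow> nat \<Rightarrow> real" where
  "sum_sd M X n = sqrt (\<Sum>k=1..n. \<integral>\<omega>. (X k \<omega>)\<^sup>2 \<partial>M)"

definition normal_dist_error :: "'a measure \<Rightarrow> (nat \<Rightarrow> 'a \<Rightarrow> real) \<Rightarrow> nat \<Rightarrow> real" where
  "normal_dist_error M X n =
     (SUP x. \<bar>measure M {\<omega> \<in> space M. partial_sum X n \<omega> < x * sum_sd M X n} - std_normal_cdf x\<bar>)"

definition lindeberg_fraction :: "'a measure \<Rightarrow> (nat \<Rightarrow> 'a \<Rightarrow> real) \<Rightarrow> nat \<Rightarrow> real" where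
  "lindeberg_fraction M X n =
     1 / (sum_sd M X n) ^ 2 *
     (\<Sum>k=1..n. \<integral>\<omega>. (X k \<omega>)\<^sup>2 * indicator {y. \<bar>y\<bar> > sum_sd M X n} (X k \<omega>) \<partial>M)"

definition truncated_lyapunov_fraction :: "'a measure \<Rightarrow> (nat \<Rightarrow> 'a \<Rightarrow> real) \<Rightarrow> nat \<Rightarrow> real" where
  "truncated_lyapunov_fraction M X n =
     1 / (sum_sd M X n) ^ 3 *
     (\<Sum>k=1..n. \<integral>\<omega>. \<bar>X k \<omega>\<bar> ^ 3 * indicator {y. \<bar>y\<bar> \<le> sum_sd M X n} (X k \<omega>) \<partial>M)"

(* C0 is a valid constant in the classical Berry--Esseen inequality. A definition cannot
   quantify over the type of the sample space, so the sample points are real sequences: every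
   sequence of random variables has the law of the coordinates on such a space, and
   berry_esseen_constD gives the inequality for sample spaces of any type. *)
definition berry_esseen_const :: "real \<Rightarrow> bool" where
  "berry_esseen_const C0 \<longleftrightarrow>
     (\<forall>(M :: (nat \<Rightarrow> real) measure) (Y :: nat \<Rightarrow> (nat \<Rightarrow> real) \<Rightarrow> real) (n :: nat).
        prob_space M \<longrightarrow>
        prob_space.indep_vars M (\<lambda>_. borel) Y {1..n} \<longrightarrow>
        (\<forall>k\<in>{1..n}. (\<integral>\<omega>. Y k \<omega> \<partial>M) = 0) \<longrightarrow>
        (\<forall>k\<in>{1..n}. integrable M (\<lambda>\<omega>. \<bar>Y k \<omega>\<bar> ^ 3)) \<longrightarrow>
        0 < (\<Sum>k=1..n. \<integral>\<omega>. (Y k \<omega>)\<^sup>2 \<partial>M) \<longrightarrow>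
        normal_dist_error M Y n
          \<le> C0 * (1 / (sum_sd M Y n) ^ 3) * (\<Sum>k=1..n. \<integral>\<omega>. \<bar>Y k \<omega>\<bar> ^ 3 \<partial>M))"

lemma berry_esseen_constD:
  fixes M :: "'a measure" and Y :: "nat \<Rightarrow> 'a \<Rightarrow> real"
  assumes C0: "berry_esseen_const C0"
    and M: "prob_space M"
    and indep: "prob_space.indep_vars M (\<lambda>_. borel) Y {1..n}"
    and mean: "\<And>k. k \<in> {1..n} \<Longrightarrow> (\<integral>\<omega>. Y k \<omega> \<partial>M) = 0"
    and third: "\<And>k. k \<in> {1..n} \<Longrightarrow> integrable M (\<lambda>\<omega>. \<bar>Y k \<omega>\<bar> ^ 3)"
    and pos: "0 < (\<Sum>k=1..n. \<integral>\<omega>. (Y k \<omega>)\<^sup>2 \<partial>M)"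
  shows "normal_dist_error M Y n
          \<le> C0 * (1 / (sum_sd M Y n) ^ 3) * (\<Sum>k=1..n. \<integral>\<omega>. \<bar>Y k \<omega>\<bar> ^ 3 \<partial>M)"
proof -
  interpret prob_space M by fact
  define T where "T \<omega> k = (if k \<in> {1..n} then Y k \<omega> else 0)" for \<omega> k
  define S where "S = PiM (UNIV :: nat set) (\<lambda>_. borel :: real measure)"
  define Q where "Q = distr M S T"
  define Z where "Z k \<omega> = \<omega> k" for k :: nat and \<omega> :: "nat \<Rightarrow> real"
  have Y [measurable]: "k \<in> {1..n} \<Longrightarrow> Y k \<in> borel_measurable M" for k
    using indep by (auto simp: indep_vars_def2)
  have Tk: "(\<lambda>\<omega>. T \<omega> k) \<in> borel_measurable M" for k
    unfolding T_def using Y[of k] by (cases "k \<in> {1..n}") auto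
  have T [measurable]: "T \<in> measurable M S"
    unfolding S_def by (rule measurable_PiM_single') (use Tk in auto)
  have Z [measurable]: "Z k \<in> borel_measurable S" for k
    unfolding S_def Z_def[abs_def] by measurable
  interpret Q: prob_space Q
    unfolding Q_def by (rule prob_space_distr) (rule T)
  have ZT: "Z k (T \<omega>) = Y k \<omega>" if "k \<in> {1..n}" for k \<omega>
    using that by (simp add: Z_def T_def)
  have int: "(\<integral>\<omega>. f (Z k \<omega>) \<partial>Q) = (\<integral>\<omega>. f (Y k \<omega>) \<partial>M)"
    if "k \<in> {1..n}" "f \<in> borel_measurable borel" for k and f :: "real \<Rightarrow> real"
    unfolding Q_def using that by (subst integral_distr) (auto simp: ZT)
  have sd: "sum_sd Q Z n = sum_sd M Y n"
    unfolding sum_sd_def by (intro arg_cong[of _ _ sqrt] sum.cong refl int) auto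
  have err: "normal_dist_error Q Z n = normal_dist_error M Y n"
  proof -
    have "measure Q {\<omega> \<in> space Q. partial_sum Z n \<omega> < t}
        = measure M {\<omega> \<in> space M. partial_sum Y n \<omega> < t}" for t
    proof -
      have "{\<omega> \<in> space S. partial_sum Z n \<omega> < t} \<in> sets S"
        unfolding partial_sum_def by measurable
      then have "measure Q {\<omega> \<in> space S. partial_sum Z n \<omega> < t}
          = measure M (T -` {\<omega> \<in> space S. partial_sum Z n \<omega> < t} \<inter> space M)"
        unfolding Q_def by (rule measure_distr[OF T])
      also have "T -` {\<omega> \<in> space S. partial_sum Z n \<omega> < t} \<inter> space M
          = {\<omega> \<in> space M. partial_sum Y n \<omega> < t}"
        using measurable_space[OF T] by (auto simp: partial_sum_def ZT)
      finally show ?thesis by (simp add: Q_def)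
    qed
    then show ?thesis by (simp add: normal_dist_error_def sd)
  qed
  have "Q.indep_vars (\<lambda>_. borel) Z {1..n}"
    unfolding Q.indep_vars_def2 Q.indep_sets_def
  proof (intro conjI ballI allI impI)
    fix k assume "k \<in> {1..n}"
    show Zk: "Q.random_variable borel (Z k)" by (simp add: Q_def)
    show "{Z k -` A \<inter> space Q |A. A \<in> sets borel} \<subseteq> Q.events"
      using Zk by (auto intro: measurable_sets)
  next
    fix J A
    assume J: "J \<subseteq> {1..n}" "J \<noteq> {}" "finite J"
      and "A \<in> Pi J (\<lambda>k. {Z k -` A \<inter> space Q |A. A \<in> sets borel})"
    then have "\<forall>j\<in>J. \<exists>B. A j = Z j -` B \<inter> space Q \<and> B \<in> sets borel" by blast
    then obtain B where B: "\<And>j. j \<in> J \<Longrightarrow> A j = Z j -` B j \<inter> space Q"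
      "\<And>j. j \<in> J \<Longrightarrow> B j \<in> sets borel" by metis
    have A: "A j \<in> sets S" if "j \<in> J" for j
      using B[OF that] measurable_sets[OF Z, of "B j" j] by (simp add: Q_def)
    have TA: "T -` A j \<inter> space M = Y j -` B j \<inter> space M" if "j \<in> J" for j
      using that J(1) B(1)[OF that] measurable_space[OF T] ZT[of j] by (auto simp: Q_def)
    have "Q.prob (\<Inter>j\<in>J. A j) = prob (T -` (\<Inter>j\<in>J. A j) \<inter> space M)"
      unfolding Q_def using A J by (intro measure_distr[OF T] sets.finite_INT) auto
    also have "T -` (\<Inter>j\<in>J. A j) \<inter> space M = (\<Inter>j\<in>J. Y j -` B j \<inter> space M)"
      using J(2) TA by blast
    also have "prob \<dots> = (\<Prod>j\<in>J. prob (Y j -` B j \<inter> space M))"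
      using indep J B(2) unfolding indep_vars_def2
      by (intro indep_setsD[where F="\<lambda>i. {Y i -` A \<inter> space M |A. A \<in> sets borel}" and I="{1..n}"]) auto
    also have "\<dots> = (\<Prod>j\<in>J. Q.prob (A j))"
      unfolding Q_def by (intro prod.cong refl) (simp add: measure_distr[OF T A] TA)
    finally show "Q.prob (\<Inter>j\<in>J. A j) = (\<Prod>j\<in>J. Q.prob (A j))" .
  qed
  moreover have "\<forall>k\<in>{1..n}. (\<integral>\<omega>. Z k \<omega> \<partial>Q) = 0"
    using int[of _ "\<lambda>x. x"] mean by simp
  moreover have "\<forall>k\<in>{1..n}. integrable Q (\<lambda>\<omega>. \<bar>Z k \<omega>\<bar> ^ 3)"
    unfolding Q_def using third by (subst integrable_distr_eq) (auto simp: ZT)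
  moreover have "0 < (\<Sum>k=1..n. \<integral>\<omega>. (Z k \<omega>)\<^sup>2 \<partial>Q)"
    using pos int[of _ "\<lambda>x. x\<^sup>2"] by simp
  ultimately have "normal_dist_error Q Z n
      \<le> C0 * (1 / (sum_sd Q Z n) ^ 3) * (\<Sum>k=1..n. \<integral>\<omega>. \<bar>Z k \<omega>\<bar> ^ 3 \<partial>Q)"
    using C0 Q.prob_space_axioms unfolding berry_esseen_const_def by blast
  also have "(\<Sum>k=1..n. \<integral>\<omega>. \<bar>Z k \<omega>\<bar> ^ 3 \<partial>Q) = (\<Sum>k=1..n. \<integral>\<omega>. \<bar>Y k \<omega>\<bar> ^ 3 \<partial>M)"
    using int[of _ "\<lambda>x. \<bar>x\<bar> ^ 3"] by simp
  finally show ?thesis by (simp only: err sd)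
qed

end

theory Submission
  imports Defs
begin

text \<open>
  Rescale so that \<open>B\<^sub>n = 1\<close> and fix \<open>b\<close>. If \<open>L\<^sub>n \<ge> (1 - b\<^sup>2) / 2\<close>, the trivial bound \<open>\<Delta>\<^sub>n \<le> 1\<close>
  suffices. Otherwise truncate the \<open>X\<^sub>k\<close> at level 1 and centre them: the resulting sum has
  variance \<open>s\<^sup>2 \<ge> 1 - 2 L\<^sub>n > b\<^sup>2\<close>, so the Berry--Esseen inequality applies to it. Truncation changes
  the sum with probability at most \<open>L\<^sub>n\<close>; the shift by the sum \<open>A\<close> of the truncated means
  (\<open>\<bar>A\<bar> \<le> L\<^sub>n\<close>) and the change of scale from \<open>s\<close> to 1 are absorbed by the Lipschitz bounds for
  the normal distribution function.
\<close>

section \<open>Increments of the standard normal distribution function\<close>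

text \<open>The increment is the integral of the density over the half-open interval. The bound
  \<open>K\<close> is local to that interval because \<open>std_normal_cdf_scale\<close> takes for
  it the value of the density at \<open>x\<close>, while the Lipschitz bound takes the global
  maximum.\<close>

lemma std_normal_cdf_diff_le:
  assumes "x \<le> y" and K: "\<And>t. x < t \<Longrightarrow> t \<le> y \<Longrightarrow> std_normal_density t \<le> K" and "0 \<le> K"
  shows "\<bar>std_normal_cdf y - std_normal_cdf x\<bar> \<le> K * (y - x)"
proof (cases "x = y")
  case False
  then have "x < y" using assms by simp
  interpret prob_space std_normal_distribution by (rule prob_space_normal_density) simp
  have fb: "finite_borel_measure std_normal_distribution"
    by unfold_locales auto
  have eq: "std_normal_cdf y - std_normal_cdf x = measure std_normal_distribution {x<..y}"
    unfolding std_normal_cdf_def by (rule finite_borel_measure.cdf_diff_eq[OF fb \<open>x < y\<close>])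
  have "emeasure std_normal_distribution {x<..y}
      = (\<integral>\<^sup>+t. ennreal (std_normal_density t) * indicator {x<..y} t \<partial>lborel)"
    by (subst emeasure_density) auto
  also have "\<dots> \<le> (\<integral>\<^sup>+t. ennreal K * indicator {x<..y} t \<partial>lborel)"
    by (intro nn_integral_mono) (auto split: split_indicator intro!: ennreal_leI K)
  also have "\<dots> = ennreal (K * (y - x))"
    using \<open>x < y\<close> \<open>0 \<le> K\<close> by (simp add: nn_integral_cmult_indicator ennreal_mult)
  finally have "measure std_normal_distribution {x<..y} \<le> K * (y - x)"
    using assms by (simp add: emeasure_eq_measure)
  then show ?thesis using eq by simp
qed simp

lemma std_normal_cdf_lipschitz:
  "\<bar>std_normal_cdf y - std_normal_cdf x\<bar> \<le> \<bar>y - x\<bar> / sqrt (2 * pi)"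
proof -
  have d: "std_normal_density t \<le> 1 / sqrt (2 * pi)" for t
    by (simp add: std_normal_density_def divide_right_mono)
  show ?thesis
    using std_normal_cdf_diff_le[of x y, OF _ d] std_normal_cdf_diff_le[of y x, OF _ d]
    by (cases "x \<le> y") (auto simp: abs_minus_commute)
qed

text \<open>Up to the factor \<open>1 / sqrt (2 * pi)\<close> the left side is u exp(-u^2/2) with u
  = |x|, which is largest at u = 1; hence the constant. Calculus is avoided by u <= exp(u - 1) <=
  exp((u^2 - 1)/2), where the second inequality is (u - 1)^2 >= 0.\<close>

lemma abs_mult_std_normal_density_le:
  "\<bar>x\<bar> * std_normal_density x \<le> exp (- 1 / 2) / sqrt (2 * pi)"
proof -
  have "\<bar>x\<bar> \<le> exp (\<bar>x\<bar> - 1)" using exp_ge_add_one_self[of "\<bar>x\<bar> - 1"] by simp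
  also have "\<dots> \<le> exp ((x\<^sup>2 - 1) / 2)"
    using zero_le_power2[of "\<bar>x\<bar> - 1"] by (simp add: power2_diff)
  finally have "\<bar>x\<bar> * exp (- (x\<^sup>2 / 2)) \<le> exp ((x\<^sup>2 - 1) / 2) * exp (- (x\<^sup>2 / 2))"
    by (rule mult_right_mono) simp
  also have "\<dots> = exp (- 1 / 2)" by (simp flip: exp_add add: field_simps)
  finally show ?thesis by (simp add: std_normal_density_def divide_right_mono)
qed

text \<open>As \<open>s\<close> is at most 1, the point x/s lies on the same side of 0 as x and no
  nearer to it, so between the two points the density is at most its value at x. The interval has
  length |x| (1/s - 1), and the factor |x| is absorbed by
  \<open>abs_mult_std_normal_density_le\<close>.\<close>

lemma std_normal_cdf_scale:
  assumes s: "0 < s" "s \<le> 1"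
  shows "\<bar>std_normal_cdf (x / s) - std_normal_cdf x\<bar> \<le> exp (- 1 / 2) / sqrt (2 * pi) * (1 / s - 1)"
proof -
  have "\<bar>std_normal_cdf (x / s) - std_normal_cdf x\<bar> \<le> std_normal_density x * (\<bar>x\<bar> * (1 / s - 1))"
  proof (cases "0 \<le> x")
    case True
    then have le: "x \<le> x / s" using s mult_left_mono[of s 1 x] by (simp add: field_simps)
    have d: "std_normal_density t \<le> std_normal_density x" if "x < t" for t
      using that True by (simp add: std_normal_density_def divide_right_mono power_mono)
    from std_normal_cdf_diff_le[OF le d] True show ?thesis by (simp add: algebra_simps)
  next
    case False
    then have le: "x / s \<le> x" using s mult_left_mono_neg[of s 1 x] by (simp add: field_simps)
    have d: "std_normal_density t \<le> std_normal_density x" if "t \<le> x" for t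
      using that False power_mono[of "-x" "-t" 2]
      by (simp add: std_normal_density_def divide_right_mono)
    from std_normal_cdf_diff_le[OF le d] False show ?thesis
      by (simp add: algebra_simps abs_minus_commute)
  qed
  also have "\<dots> = \<bar>x\<bar> * std_normal_density x * (1 / s - 1)" by simp
  also have "\<dots> \<le> exp (- 1 / 2) / sqrt (2 * pi) * (1 / s - 1)"
    using s by (intro mult_right_mono abs_mult_std_normal_density_le) (simp add: field_simps)
  finally show ?thesis .
qed

lemma std_normal_cdf_range: "0 \<le> std_normal_cdf x" "std_normal_cdf x \<le> 1"
proof -
  interpret prob_space std_normal_distribution by (rule prob_space_normal_density) simp
  show "0 \<le> std_normal_cdf x" "std_normal_cdf x \<le> 1"
    by (simp_all add: std_normal_cdf_def cdf_def)
qed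

section \<open>Elementary bounds on the error, and moments of a truncated and centred
  variable\<close>

context prob_space
begin

lemma abs_prob_minus_std_normal_cdf_le_1: "\<bar>prob A - std_normal_cdf x\<bar> \<le> 1"
  using std_normal_cdf_range[of x] prob_le_1[of A] measure_nonneg[of M A] by linarith

text \<open>The supremum of reals dominates its members only when they are bounded above; the bound
  here is 1, a difference of two numbers in [0, 1].\<close>

lemma normal_dist_error_upper:
  "\<bar>prob {\<omega> \<in> space M. partial_sum X n \<omega> < x * sum_sd M X n} - std_normal_cdf x\<bar>
    \<le> normal_dist_error M X n"
  unfolding normal_dist_error_def
  by (rule cSUP_upper) (auto intro!: bdd_aboveI2 abs_prob_minus_std_normal_cdf_le_1)

lemma normal_dist_error_nonneg: "0 \<le> normal_dist_error M X n"
  by (rule order_trans[OF abs_ge_zero normal_dist_error_upper[of X n 0]])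

text \<open>Only one of the three factors |T - a| is estimated, by |T| + |a|; the square of the
  other two is expanded exactly. This keeps the coefficient of the third moment at 1 and makes the
  cost of centring linear in |a|.\<close>

lemma third_moment_centred_le:
  fixes T :: "'a \<Rightarrow> real"
  assumes [measurable]: "T \<in> borel_measurable M" and bd: "\<And>\<omega>. \<bar>T \<omega>\<bar> \<le> 1"
  defines "a \<equiv> expectation T"
  shows "(\<integral>\<omega>. \<bar>T \<omega> - a\<bar> ^ 3 \<partial>M) \<le> (\<integral>\<omega>. \<bar>T \<omega>\<bar> ^ 3 \<partial>M) + 4 * \<bar>a\<bar>"
proof -
  have bdp: "\<bar>T \<omega>\<bar> ^ k \<le> 1" for \<omega> k using bd by (simp add: power_le_one)
  have int: "integrable M (\<lambda>\<omega>. \<bar>T \<omega>\<bar> ^ k)" "integrable M (\<lambda>\<omega>. T \<omega> ^ k)"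
    "integrable M (\<lambda>\<omega>. T \<omega> * \<bar>T \<omega>\<bar>)" for k
    using bd by (auto intro!: integrable_const_bound[where B=1] AE_I2
        simp: power_abs bdp abs_mult mult_le_one simp del: abs_mult_self_eq)
  note int' = int(1)[of 1, simplified] int(2)[of 1, simplified] int(1)[of 3] int(2)[of 2] int(3)
  have a1: "\<bar>a\<bar> \<le> 1"
  proof -
    have "\<bar>a\<bar> \<le> (\<integral>\<omega>. \<bar>T \<omega>\<bar> \<partial>M)" unfolding a_def by (rule integral_abs_bound)
    also have "\<dots> \<le> (\<integral>\<omega>. 1 \<partial>M)" using int' bd by (intro integral_mono) auto
    finally show ?thesis by (simp add: prob_space)
  qed
  \<comment> \<open>\<open>?g\<close> is (|T| + |a|) (T - a)^2 multiplied out.\<close>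
  let ?g = "\<lambda>\<omega>. \<bar>T \<omega>\<bar> ^ 3 - 2 * a * (T \<omega> * \<bar>T \<omega>\<bar>) + a\<^sup>2 * \<bar>T \<omega>\<bar>
     + \<bar>a\<bar> * (T \<omega>)\<^sup>2 - 2 * (a * \<bar>a\<bar>) * T \<omega> + a\<^sup>2 * \<bar>a\<bar>"
  have point: "\<bar>T \<omega> - a\<bar> ^ 3 \<le> ?g \<omega>" for \<omega>
  proof -
    have "\<bar>T \<omega> - a\<bar> ^ 3 = \<bar>T \<omega> - a\<bar> * (T \<omega> - a)\<^sup>2"
      by (simp add: power3_eq_cube power2_eq_square)
    also have "\<dots> \<le> (\<bar>T \<omega>\<bar> + \<bar>a\<bar>) * (T \<omega> - a)\<^sup>2" by (intro mult_right_mono) auto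
    also have "\<dots> = ?g \<omega>"
    proof -
      have "\<bar>T \<omega>\<bar> ^ 3 = \<bar>T \<omega>\<bar> * (T \<omega>)\<^sup>2" by (simp add: power3_eq_cube power2_eq_square)
      then show ?thesis by (simp add: power2_eq_square algebra_simps)
    qed
    finally show ?thesis .
  qed
  have intY: "integrable M (\<lambda>\<omega>. \<bar>T \<omega> - a\<bar> ^ 3)"
  proof (rule integrable_const_bound[where B="2 ^ 3"])
    have "\<bar>T \<omega> - a\<bar> ^ 3 \<le> 2 ^ 3" for \<omega>
      using bd[of \<omega>] a1 by (intro power_mono) linarith+
    then show "AE \<omega> in M. norm (\<bar>T \<omega> - a\<bar> ^ 3) \<le> 2 ^ 3" by simp
  qed simp
  have "(\<integral>\<omega>. \<bar>T \<omega> - a\<bar> ^ 3 \<partial>M) \<le> (\<integral>\<omega>. ?g \<omega> \<partial>M)"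
    by (intro integral_mono intY point Bochner_Integration.integrable_add
        Bochner_Integration.integrable_diff integrable_mult_right int' integrable_const)
  also have "\<dots> = (\<integral>\<omega>. \<bar>T \<omega>\<bar> ^ 3 \<partial>M) - 2 * a * (\<integral>\<omega>. T \<omega> * \<bar>T \<omega>\<bar> \<partial>M)
      + a\<^sup>2 * (\<integral>\<omega>. \<bar>T \<omega>\<bar> \<partial>M) + \<bar>a\<bar> * (\<integral>\<omega>. (T \<omega>)\<^sup>2 \<partial>M) - 2 * (a * \<bar>a\<bar>) * a + a\<^sup>2 * \<bar>a\<bar>"
    using int' by (simp add: prob_space a_def)
  \<comment> \<open>The 4 is 2 + 1 + 1: the term with T |T| costs 2|a|, and the terms with a^2 |T|
    and |a| T^2 cost |a| each, since |T| and |a| are at most 1. The last two terms add up to -2|a|^3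
    + |a|^3 <= 0.\<close>
  also have "\<dots> \<le> (\<integral>\<omega>. \<bar>T \<omega>\<bar> ^ 3 \<partial>M) + 4 * \<bar>a\<bar>"
  proof -
    have "\<bar>\<integral>\<omega>. T \<omega> * \<bar>T \<omega>\<bar> \<partial>M\<bar> \<le> (\<integral>\<omega>. \<bar>T \<omega> * \<bar>T \<omega>\<bar>\<bar> \<partial>M)" by (rule integral_abs_bound)
    also have "\<dots> \<le> (\<integral>\<omega>. 1 \<partial>M)"
      using int' bd by (intro integral_mono integrable_abs)
        (auto simp: abs_mult mult_le_one simp del: abs_mult_self_eq)
    finally have 1: "\<bar>\<integral>\<omega>. T \<omega> * \<bar>T \<omega>\<bar> \<partial>M\<bar> \<le> 1" by (simp add: prob_space)
    have "- (2 * a * (\<integral>\<omega>. T \<omega> * \<bar>T \<omega>\<bar> \<partial>M)) \<le> 2 * (\<bar>a\<bar> * \<bar>\<integral>\<omega>. T \<omega> * \<bar>T \<omega>\<bar> \<partial>M\<bar>)"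
      by (simp flip: abs_mult)
    also have "\<dots> \<le> 2 * \<bar>a\<bar>" using mult_left_mono[OF 1, of "\<bar>a\<bar>"] by simp
    finally have A: "- (2 * a * (\<integral>\<omega>. T \<omega> * \<bar>T \<omega>\<bar> \<partial>M)) \<le> 2 * \<bar>a\<bar>" .
    have "(\<integral>\<omega>. \<bar>T \<omega>\<bar> \<partial>M) \<le> (\<integral>\<omega>. 1 \<partial>M)" using int' bd by (intro integral_mono) auto
    then have "a\<^sup>2 * (\<integral>\<omega>. \<bar>T \<omega>\<bar> \<partial>M) \<le> \<bar>a\<bar> * 1"
      using a1 mult_left_mono[of "\<bar>a\<bar>" 1 "\<bar>a\<bar>"]
      by (intro mult_mono) (auto simp: prob_space power2_eq_square)
    then have B: "a\<^sup>2 * (\<integral>\<omega>. \<bar>T \<omega>\<bar> \<partial>M) \<le> \<bar>a\<bar>" by simp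
    have "(\<integral>\<omega>. (T \<omega>)\<^sup>2 \<partial>M) \<le> (\<integral>\<omega>. 1 \<partial>M)"
      using int' bd by (intro integral_mono) (auto simp: abs_square_le_1)
    then have C: "\<bar>a\<bar> * (\<integral>\<omega>. (T \<omega>)\<^sup>2 \<partial>M) \<le> \<bar>a\<bar>"
      using mult_left_mono[of "\<integral>\<omega>. (T \<omega>)\<^sup>2 \<partial>M" 1 "\<bar>a\<bar>"] by (simp add: prob_space)
    have D: "- (2 * (a * \<bar>a\<bar>) * a) + a\<^sup>2 * \<bar>a\<bar> \<le> 0"
    proof -
      have "0 \<le> a\<^sup>2 * \<bar>a\<bar>" by simp
      moreover have "2 * (a * \<bar>a\<bar>) * a = 2 * (a\<^sup>2 * \<bar>a\<bar>)" by (simp add: power2_eq_square)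
      ultimately show ?thesis by linarith
    qed
    show ?thesis using A B C D by linarith
  qed
  finally show ?thesis .
qed

text \<open>Where |X| > 1, both 1 and |X| are at most X^2, so \<open>l\<close> dominates the tail
  probability and the tail mean. As X has mean 0, the mean of T is minus the tail mean. The second
  moment of T is that of X less \<open>l\<close>, and centring subtracts a further (E T)^2 <= l^2 <=
  l. The third moment comes from \<open>third_moment_centred_le\<close>.\<close>

lemma truncation_bounds:
  fixes X :: "'a \<Rightarrow> real"
  assumes [measurable]: "X \<in> borel_measurable M"
    and mean: "expectation X = 0"
    and sq: "integrable M (\<lambda>\<omega>. (X \<omega>)\<^sup>2)" and var: "(\<integral>\<omega>. (X \<omega>)\<^sup>2 \<partial>M) \<le> 1"
  defines "T \<equiv> \<lambda>\<omega>. X \<omega> * indicator {y. \<bar>y\<bar> \<le> 1} (X \<omega>)"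
    and "l \<equiv> \<integral>\<omega>. (X \<omega>)\<^sup>2 * indicator {y. \<bar>y\<bar> > 1} (X \<omega>) \<partial>M"
  shows "\<bar>expectation T\<bar> \<le> l"
    and "prob {\<omega> \<in> space M. \<bar>X \<omega>\<bar> > 1} \<le> l"
    and "(\<integral>\<omega>. (X \<omega>)\<^sup>2 \<partial>M) - 2 * l \<le> (\<integral>\<omega>. (T \<omega> - expectation T)\<^sup>2 \<partial>M)"
    and "(\<integral>\<omega>. (T \<omega> - expectation T)\<^sup>2 \<partial>M) \<le> (\<integral>\<omega>. (X \<omega>)\<^sup>2 \<partial>M)"
    and "(\<integral>\<omega>. \<bar>T \<omega> - expectation T\<bar> ^ 3 \<partial>M)
       \<le> (\<integral>\<omega>. \<bar>X \<omega>\<bar> ^ 3 * indicator {y. \<bar>y\<bar> \<le> 1} (X \<omega>) \<partial>M) + 4 * l"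
proof -
  have [measurable]: "T \<in> borel_measurable M" unfolding T_def by measurable
  have bd: "\<bar>T \<omega>\<bar> \<le> 1" for \<omega> by (simp add: T_def split: split_indicator)
  have intX: "integrable M X" using sq by (rule square_integrable_imp_integrable[rotated]) simp
  have intT: "integrable M T" "integrable M (\<lambda>\<omega>. (T \<omega>)\<^sup>2)"
    using bd by (auto intro!: integrable_const_bound[where B=1] simp: abs_square_le_1)
  let ?U = "\<lambda>\<omega>. X \<omega> * indicator {y. \<bar>y\<bar> > 1} (X \<omega>)"
  let ?V = "\<lambda>\<omega>. (X \<omega>)\<^sup>2 * indicator {y. \<bar>y\<bar> > 1} (X \<omega>)"
  have intV: "integrable M ?V"
    by (rule Bochner_Integration.integrable_bound[OF sq]) (auto split: split_indicator)
  have intU: "integrable M ?U"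
    by (rule Bochner_Integration.integrable_bound[OF intX]) (auto split: split_indicator)
  have "expectation X = (\<integral>\<omega>. T \<omega> + ?U \<omega> \<partial>M)"
    by (rule Bochner_Integration.integral_cong) (auto simp: T_def split: split_indicator)
  then have TU: "expectation T = - expectation ?U" using intT intU mean by simp
  have "\<bar>expectation ?U\<bar> \<le> (\<integral>\<omega>. \<bar>?U \<omega>\<bar> \<partial>M)" by (rule integral_abs_bound)
  also have "\<dots> \<le> l" unfolding l_def
  proof (intro integral_mono integrable_abs intU intV)
    fix \<omega> show "\<bar>?U \<omega>\<bar> \<le> ?V \<omega>"
      using mult_left_mono[of 1 "\<bar>X \<omega>\<bar>" "\<bar>X \<omega>\<bar>"]
      by (auto simp: power2_eq_square split: split_indicator)
  qed
  finally show al: "\<bar>expectation T\<bar> \<le> l" using TU by simp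
  have "prob {\<omega> \<in> space M. \<bar>X \<omega>\<bar> > 1} = (\<integral>\<omega>. indicator {\<omega> \<in> space M. \<bar>X \<omega>\<bar> > 1} \<omega> \<partial>M)"
    by simp
  also have "\<dots> \<le> l" unfolding l_def
  proof (intro integral_mono intV)
    fix \<omega> show "indicator {\<omega> \<in> space M. \<bar>X \<omega>\<bar> > 1} \<omega> \<le> ?V \<omega>"
      using power_mono[of 1 "\<bar>X \<omega>\<bar>" 2] by (auto split: split_indicator)
  qed (auto simp: emeasure_eq_measure)
  finally show "prob {\<omega> \<in> space M. \<bar>X \<omega>\<bar> > 1} \<le> l" .
  have "(\<integral>\<omega>. (X \<omega>)\<^sup>2 \<partial>M) = (\<integral>\<omega>. (T \<omega>)\<^sup>2 + ?V \<omega> \<partial>M)"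
    by (rule Bochner_Integration.integral_cong) (auto simp: T_def split: split_indicator)
  then have sqT: "(\<integral>\<omega>. (T \<omega>)\<^sup>2 \<partial>M) = (\<integral>\<omega>. (X \<omega>)\<^sup>2 \<partial>M) - l"
    using intT intV by (simp add: l_def)
  have varT: "(\<integral>\<omega>. (T \<omega> - expectation T)\<^sup>2 \<partial>M) = (\<integral>\<omega>. (T \<omega>)\<^sup>2 \<partial>M) - (expectation T)\<^sup>2"
    by (rule variance_eq) (use intT in auto)
  have l0: "0 \<le> l" using al by linarith
  \<comment> \<open>Since E T^2 = E X^2 - l is nonnegative and E X^2 is at most 1, also l <= 1; this
    is what allows l^2 to be replaced by l.\<close>
  have "0 \<le> (\<integral>\<omega>. (T \<omega>)\<^sup>2 \<partial>M)" by (rule Bochner_Integration.integral_nonneg) simp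
  then have l1: "l \<le> 1" using sqT var by linarith
  have "(expectation T)\<^sup>2 \<le> l\<^sup>2" using al l0 by (simp add: abs_le_square_iff[symmetric])
  also have "\<dots> \<le> l" using l0 l1 mult_left_mono[of l 1 l] by (simp add: power2_eq_square)
  finally show "(\<integral>\<omega>. (X \<omega>)\<^sup>2 \<partial>M) - 2 * l \<le> (\<integral>\<omega>. (T \<omega> - expectation T)\<^sup>2 \<partial>M)"
    using varT sqT by linarith
  show "(\<integral>\<omega>. (T \<omega> - expectation T)\<^sup>2 \<partial>M) \<le> (\<integral>\<omega>. (X \<omega>)\<^sup>2 \<partial>M)"
    using varT sqT l0 zero_le_power2[of "expectation T"] by linarith
  have "(\<integral>\<omega>. \<bar>T \<omega>\<bar> ^ 3 \<partial>M) = (\<integral>\<omega>. \<bar>X \<omega>\<bar> ^ 3 * indicator {y. \<bar>y\<bar> \<le> 1} (X \<omega>) \<partial>M)"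
    by (rule Bochner_Integration.integral_cong) (auto simp: T_def split: split_indicator)
  with third_moment_centred_le[of T] bd al
  show "(\<integral>\<omega>. \<bar>T \<omega> - expectation T\<bar> ^ 3 \<partial>M)
       \<le> (\<integral>\<omega>. \<bar>X \<omega>\<bar> ^ 3 * indicator {y. \<bar>y\<bar> \<le> 1} (X \<omega>) \<partial>M) + 4 * l"
    by force
qed


section \<open>Transfer of the error from one sum to another\<close>

text \<open>A triangle inequality with one summand per change: replacing each \<open>X k\<close> by
  \<open>Y k + a k\<close>, passing from the law of the sum of the \<open>Y k\<close> to the normal
  law, removing the shift by the sum of the \<open>a k\<close>, and rescaling from the standard
  deviation of the \<open>Y\<close> sum to 1.\<close>

lemma normal_dist_error_le_of_coupling:
  assumes [measurable]: "\<And>k. k \<in> {1..n} \<Longrightarrow> X k \<in> borel_measurable M"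
    "\<And>k. k \<in> {1..n} \<Longrightarrow> Y k \<in> borel_measurable M"
    and sdX: "sum_sd M X n = 1" and sdY: "0 < sum_sd M Y n" "sum_sd M Y n \<le> 1"
  shows "normal_dist_error M X n \<le>
      (\<Sum>k=1..n. prob {\<omega> \<in> space M. X k \<omega> \<noteq> Y k \<omega> + a k}) + normal_dist_error M Y n
      + \<bar>\<Sum>k=1..n. a k\<bar> / (sqrt (2 * pi) * sum_sd M Y n)
      + exp (- 1 / 2) / sqrt (2 * pi) * (1 / sum_sd M Y n - 1)"
  (is "_ \<le> ?R")
proof -
  define s A where "s = sum_sd M Y n" and "A = (\<Sum>k=1..n. a k)"
  have s: "0 < s" "s \<le> 1" using sdY by (simp_all add: s_def)
  have bound: "\<bar>prob {\<omega> \<in> space M. partial_sum X n \<omega> < x} - std_normal_cdf x\<bar> \<le> ?R" for x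
  proof -
    \<comment> \<open>With this choice \<open>y * s\<close> equals x - A, so the events E and F
      agree wherever every \<open>X k\<close> equals \<open>Y k + a k\<close>, and F has the form to
      which the error of the \<open>Y\<close> sum refers.\<close>
    define y where "y = (x - A) / s"
    define E where "E = {\<omega> \<in> space M. partial_sum X n \<omega> < x}"
    define F where "F = {\<omega> \<in> space M. partial_sum Y n \<omega> < y * s}"
    define D where "D k = {\<omega> \<in> space M. X k \<omega> \<noteq> Y k \<omega> + a k}" for k
    have [measurable]: "E \<in> events" "F \<in> events" unfolding E_def F_def partial_sum_def by measurable
    have Dm: "D k \<in> events" if "k \<in> {1..n}" for k
      unfolding D_def using assms(1,2)[OF that] by measurable
    have UD: "(\<Union>k\<in>{1..n}. D k) \<in> events" using Dm by auto
    have agree: "\<omega> \<in> E \<longleftrightarrow> \<omega> \<in> F" if "\<omega> \<in> space M" "\<omega> \<notin> (\<Union>k\<in>{1..n}. D k)" for \<omega>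
    proof -
      have "partial_sum X n \<omega> = (\<Sum>k=1..n. Y k \<omega> + a k)"
        unfolding partial_sum_def using that by (intro sum.cong) (auto simp: D_def)
      also have "\<dots> = partial_sum Y n \<omega> + A" by (simp add: partial_sum_def A_def sum.distrib)
      finally show ?thesis using that s by (auto simp: E_def F_def y_def)
    qed
    have "prob E \<le> prob (F \<union> (\<Union>k\<in>{1..n}. D k))"
      using agree UD sets.sets_into_space[OF \<open>E \<in> events\<close>] by (intro finite_measure_mono) auto
    also have "\<dots> \<le> prob F + prob (\<Union>k\<in>{1..n}. D k)"
      using UD by (intro measure_Un_le) auto
    finally have 1: "prob E \<le> prob F + prob (\<Union>k\<in>{1..n}. D k)" .
    have "prob F \<le> prob (E \<union> (\<Union>k\<in>{1..n}. D k))"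
      using agree UD sets.sets_into_space[OF \<open>F \<in> events\<close>] by (intro finite_measure_mono) auto
    also have "\<dots> \<le> prob E + prob (\<Union>k\<in>{1..n}. D k)"
      using UD by (intro measure_Un_le) auto
    finally have 2: "prob F \<le> prob E + prob (\<Union>k\<in>{1..n}. D k)" .
    have "prob (\<Union>k\<in>{1..n}. D k) \<le> (\<Sum>k=1..n. prob (D k))"
      using Dm by (intro finite_measure_subadditive_finite) auto
    with 1 2 have I: "\<bar>prob E - prob F\<bar> \<le> (\<Sum>k=1..n. prob (D k))" by linarith
    have II: "\<bar>prob F - std_normal_cdf y\<bar> \<le> normal_dist_error M Y n"
      unfolding F_def s_def by (rule normal_dist_error_upper)
    \<comment> \<open>The shift is removed before the scale: the two arguments differ by A/s, and
      x/s is then compared with x by \<open>std_normal_cdf_scale\<close>.\<close>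
    have "\<bar>std_normal_cdf y - std_normal_cdf (x / s)\<bar> \<le> \<bar>y - x / s\<bar> / sqrt (2 * pi)"
      by (rule std_normal_cdf_lipschitz)
    also have "\<bar>y - x / s\<bar> = \<bar>A\<bar> / s"
    proof -
      have "y - x / s = - A / s" using s by (simp add: y_def field_simps)
      then show ?thesis using s by simp
    qed
    finally have III: "\<bar>std_normal_cdf y - std_normal_cdf (x / s)\<bar> \<le> \<bar>A\<bar> / (sqrt (2 * pi) * s)"
      by (simp add: mult.commute)
    show ?thesis
      using I II III std_normal_cdf_scale[OF s, of x] unfolding E_def D_def A_def s_def by linarith
  qed
  show ?thesis
    unfolding normal_dist_error_def[of M X] sdX by (rule cSUP_least) (use bound in auto)
qed

section \<open>The Berry--Esseen inequality for the truncated sum, and the case of unit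
  variance\<close>

text \<open>Replacing the standard deviation by a lower bound and the third moments by an upper
  bound is monotone only if \<open>C0\<close> is nonnegative. That sign is derived: the error is
  nonnegative and the quantity multiplying \<open>C0\<close> is strictly positive.\<close>

lemma berry_esseen_bound_relax:
  assumes C0: "berry_esseen_const C0"
    and indep: "indep_vars (\<lambda>_. borel) Y {1..n}"
    and mean: "\<And>k. k \<in> {1..n} \<Longrightarrow> expectation (Y k) = 0"
    and third: "\<And>k. k \<in> {1..n} \<Longrightarrow> integrable M (\<lambda>\<omega>. \<bar>Y k \<omega>\<bar> ^ 3)"
    and b: "0 < b" "b \<le> sum_sd M Y n"
    and le: "(\<Sum>k=1..n. \<integral>\<omega>. \<bar>Y k \<omega>\<bar> ^ 3 \<partial>M) \<le> U"
  shows "0 \<le> C0" "normal_dist_error M Y n \<le> C0 / b ^ 3 * U"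
proof -
  let ?s = "sum_sd M Y n" and ?W = "\<Sum>k=1..n. \<integral>\<omega>. \<bar>Y k \<omega>\<bar> ^ 3 \<partial>M"
  have s: "0 < ?s" using b by linarith
  then have pos: "0 < (\<Sum>k=1..n. \<integral>\<omega>. (Y k \<omega>)\<^sup>2 \<partial>M)" by (simp add: sum_sd_def)
  have be: "normal_dist_error M Y n \<le> C0 * (1 / ?s ^ 3) * ?W"
    by (rule berry_esseen_constD[OF C0 prob_space_axioms indep mean third pos])
  have nn: "0 \<le> (\<integral>\<omega>. \<bar>Y k \<omega>\<bar> ^ 3 \<partial>M)" for k
    by (rule Bochner_Integration.integral_nonneg) simp
  have W0: "0 \<le> ?W" by (intro sum_nonneg nn)
  \<comment> \<open>If all third absolute moments vanished, every \<open>Y k\<close> would be 0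
    almost everywhere, against the positive variance.\<close>
  have "?W \<noteq> 0"
  proof
    assume "?W = 0"
    then have z: "(\<integral>\<omega>. \<bar>Y k \<omega>\<bar> ^ 3 \<partial>M) = 0" if "k \<in> {1..n}" for k
      using sum_nonneg_eq_0_iff[of "{1..n}" "\<lambda>k. \<integral>\<omega>. \<bar>Y k \<omega>\<bar> ^ 3 \<partial>M"] nn that by auto
    have "(\<integral>\<omega>. (Y k \<omega>)\<^sup>2 \<partial>M) = 0" if "k \<in> {1..n}" for k
    proof -
      have "AE \<omega> in M. \<bar>Y k \<omega>\<bar> ^ 3 = 0"
        using z[OF that] integral_nonneg_eq_0_iff_AE[OF third[OF that]] by simp
      then show ?thesis by (intro integral_eq_zero_AE) auto
    qed
    then show False using pos by simp
  qed
  with W0 have W: "0 < ?W" by simp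
  have "0 \<le> C0 * (1 / ?s ^ 3 * ?W)"
    using order_trans[OF normal_dist_error_nonneg be] by (simp only: mult.assoc)
  moreover have "0 < 1 / ?s ^ 3 * ?W" using s W by simp
  ultimately show C: "0 \<le> C0" by (simp only: zero_le_mult_iff) auto
  note be
  also have "C0 * (1 / ?s ^ 3) * ?W \<le> C0 * (1 / b ^ 3) * U"
    using b s C W0 le by (intro mult_mono mult_nonneg_nonneg divide_left_mono power_mono) auto
  finally show "normal_dist_error M Y n \<le> C0 / b ^ 3 * U" by simp
qed

lemma normal_dist_error_le_normalized:
  assumes indep: "indep_vars (\<lambda>_. borel) X {1..n}"
    and mean: "\<And>k. k \<in> {1..n} \<Longrightarrow> expectation (X k) = 0"
    and sq: "\<And>k. k \<in> {1..n} \<Longrightarrow> integrable M (\<lambda>\<omega>. (X k \<omega>)\<^sup>2)"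
    and sd: "sum_sd M X n = 1" and C0: "berry_esseen_const C0" and b: "0 < b" "b < 1"
  shows "normal_dist_error M X n
    \<le> max (2 / (1 - b\<^sup>2))
          (1 + 4.25 * C0 / b ^ 3 + 1 / (sqrt (2 * pi) * b) * (1 + 2 * exp (- 1 / 2) / (1 + b)))
      * (lindeberg_fraction M X n + truncated_lyapunov_fraction M X n)"
    (is "_ \<le> max ?c1 ?c2 * (?L + ?N)")
proof -
  define l where "l k = (\<integral>\<omega>. (X k \<omega>)\<^sup>2 * indicator {y. \<bar>y\<bar> > 1} (X k \<omega>) \<partial>M)" for k
  define m where "m k = (\<integral>\<omega>. \<bar>X k \<omega>\<bar> ^ 3 * indicator {y. \<bar>y\<bar> \<le> 1} (X k \<omega>) \<partial>M)" for k
  have L: "?L = sum l {1..n}" and N: "?N = sum m {1..n}"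
    by (simp_all add: lindeberg_fraction_def truncated_lyapunov_fraction_def sd l_def m_def)
  have L0: "0 \<le> ?L" and N0: "0 \<le> ?N"
    unfolding L N l_def m_def by (intro sum_nonneg Bochner_Integration.integral_nonneg; simp)+
  have b2: "b\<^sup>2 < 1" using b by (simp add: abs_square_less_1)
  \<comment> \<open>Each argument of the maximum settles one case. At the threshold
    \<open>1 - b\<^sup>2 = 2 * ?L\<close> the first one times \<open>?L\<close> is exactly 1; below
    it, 1 - 2L exceeds b^2, which keeps the truncated sum's standard deviation above b.\<close>
  show ?thesis
  proof (cases "1 - b\<^sup>2 \<le> 2 * ?L")
    case True
    have "normal_dist_error M X n \<le> 1"
      unfolding normal_dist_error_def by (rule cSUP_least) (auto intro: abs_prob_minus_std_normal_cdf_le_1)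
    also have "1 \<le> ?c1 * ?L" using True b2 by (simp add: field_simps)
    also have "\<dots> \<le> max ?c1 ?c2 * (?L + ?N)"
      using L0 N0 b2 by (intro mult_mono) (auto simp: le_max_iff_disj)
    finally show ?thesis .
  next
    case False
    have X [measurable]: "X k \<in> borel_measurable M" if "k \<in> {1..n}" for k
      using indep that by (auto simp: indep_vars_def2)
    have var: "(\<Sum>k=1..n. \<integral>\<omega>. (X k \<omega>)\<^sup>2 \<partial>M) = 1"
      using sd unfolding sum_sd_def by (simp only: real_sqrt_eq_1_iff)
    have var1: "(\<integral>\<omega>. (X k \<omega>)\<^sup>2 \<partial>M) \<le> 1" if "k \<in> {1..n}" for k
      unfolding var[symmetric] using that by (intro member_le_sum) auto
    define T where "T k \<omega> = X k \<omega> * indicator {y. \<bar>y\<bar> \<le> 1} (X k \<omega>)" for k \<omega>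
    define a where "a k = expectation (T k)" for k
    define Y where "Y k \<omega> = T k \<omega> - a k" for k \<omega>
    have Y [measurable]: "Y k \<in> borel_measurable M" if "k \<in> {1..n}" for k
      unfolding Y_def T_def using X[OF that] by measurable
    \<comment> \<open>In order, \<open>tb\<close> bounds the truncated mean, the tail probability,
      the variance of \<open>Y k\<close> from below and from above, and its third absolute
      moment.\<close>
    note tb = truncation_bounds[OF X mean sq var1, folded T_def l_def m_def a_def, folded Y_def]
    define s where "s = sum_sd M Y n"
    have s2: "s\<^sup>2 = (\<Sum>k=1..n. \<integral>\<omega>. (Y k \<omega>)\<^sup>2 \<partial>M)"
      unfolding s_def sum_sd_def by (intro real_sqrt_pow2 sum_nonneg Bochner_Integration.integral_nonneg) simp
    have "1 - 2 * ?L = (\<Sum>k=1..n. (\<integral>\<omega>. (X k \<omega>)\<^sup>2 \<partial>M) - 2 * l k)"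
      unfolding sum_subtractf var L sum_distrib_left ..
    also have "\<dots> \<le> s\<^sup>2" unfolding s2 by (intro sum_mono tb(3)) auto
    finally have s_lower: "1 - 2 * ?L \<le> s\<^sup>2" .
    have "s\<^sup>2 \<le> (\<Sum>k=1..n. \<integral>\<omega>. (X k \<omega>)\<^sup>2 \<partial>M)" unfolding s2 by (intro sum_mono tb(4)) auto
    then have s1: "s \<le> 1" unfolding var using power2_le_imp_le[of s 1] by simp
    have s0: "0 \<le> s" unfolding s_def sum_sd_def
      by (intro real_sqrt_ge_zero sum_nonneg Bochner_Integration.integral_nonneg) simp
    have bs: "b \<le> s" using False s_lower s0 by (simp add: power2_le_imp_le[of b s])
    have s: "0 < s" using b bs by linarith
    have indepY: "indep_vars (\<lambda>_. borel) Y {1..n}"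
      using indep_vars_compose2[OF indep, of "\<lambda>k x. x * indicator {y. \<bar>y\<bar> \<le> 1} x - a k" "\<lambda>_. borel"]
      by (simp add: Y_def[abs_def] T_def)
    have T1: "\<bar>T k \<omega>\<bar> \<le> 1" for k \<omega> by (simp add: T_def split: split_indicator)
    have meanY: "expectation (Y k) = 0" if "k \<in> {1..n}" for k
    proof -
      have "T k \<in> borel_measurable M" unfolding T_def using X[OF that] by measurable
      then have "integrable M (T k)" using T1 by (intro integrable_const_bound[where B=1]) auto
      then show ?thesis by (simp add: Y_def[abs_def] a_def prob_space)
    qed
    have thirdY: "integrable M (\<lambda>\<omega>. \<bar>Y k \<omega>\<bar> ^ 3)" if "k \<in> {1..n}" for k
    proof (rule integrable_const_bound[where B="(1 + \<bar>a k\<bar>) ^ 3"])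
      have "\<bar>Y k \<omega>\<bar> ^ 3 \<le> (1 + \<bar>a k\<bar>) ^ 3" for \<omega>
        using T1[of k \<omega>] unfolding Y_def by (intro power_mono) linarith+
      then show "AE \<omega> in M. norm (\<bar>Y k \<omega>\<bar> ^ 3) \<le> (1 + \<bar>a k\<bar>) ^ 3" by simp
    qed (use Y[OF that] in measurable)
    have "(\<Sum>k=1..n. \<integral>\<omega>. \<bar>Y k \<omega>\<bar> ^ 3 \<partial>M) \<le> (\<Sum>k=1..n. m k + 4 * l k)"
      by (intro sum_mono tb(5)) auto
    also have "\<dots> = ?N + 4 * ?L" by (simp add: L N sum.distrib sum_distrib_left)
    \<comment> \<open>The coefficients 1 of \<open>?N\<close> and 4 of \<open>?L\<close> are both
      dominated by the 4.25 that multiplies \<open>C0\<close> in the final constant.\<close>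
    also have "\<dots> \<le> 4.25 * (?L + ?N)" using L0 N0 by simp
    finally have "(\<Sum>k=1..n. \<integral>\<omega>. \<bar>Y k \<omega>\<bar> ^ 3 \<partial>M) \<le> 4.25 * (?L + ?N)" .
    from berry_esseen_bound_relax[OF C0 indepY meanY thirdY \<open>0 < b\<close> bs[unfolded s_def] this]
    have C: "0 \<le> C0" and be: "normal_dist_error M Y n \<le> C0 / b ^ 3 * (4.25 * (?L + ?N))" by simp_all
    have "(\<Sum>k=1..n. prob {\<omega> \<in> space M. X k \<omega> \<noteq> Y k \<omega> + a k}) \<le> ?L"
    proof -
      \<comment> \<open>Adding \<open>a k\<close> undoes the centring and leaves \<open>T k\<close>,
        which is 0 when |X_k| > 1 and equals \<open>X k\<close> otherwise.\<close>
      have "{\<omega> \<in> space M. X k \<omega> \<noteq> Y k \<omega> + a k} = {\<omega> \<in> space M. \<bar>X k \<omega>\<bar> > 1}" for k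
        by (auto simp: Y_def T_def split: split_indicator_asm split_indicator)
      then show ?thesis unfolding L by (simp only:) (intro sum_mono tb(2), auto)
    qed
    moreover
    have "\<bar>\<Sum>k=1..n. a k\<bar> \<le> ?L"
      unfolding L by (intro order_trans[OF sum_abs] sum_mono tb(1)) auto
    then have "\<bar>\<Sum>k=1..n. a k\<bar> / (sqrt (2 * pi) * s) \<le> ?L / (sqrt (2 * pi) * b)"
      using b bs s L0 by (intro frac_le mult_left_mono) auto
    moreover
    have "exp (- 1 / 2) / sqrt (2 * pi) * (1 / s - 1)
        \<le> exp (- 1 / 2) / sqrt (2 * pi) * (2 * ?L / (b * (1 + b)))"
    proof (intro mult_left_mono)
      \<comment> \<open>Factoring turns 1/s - 1 into (1 - s^2) / (s (1 + s)), so the variance loss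
        of at most 2L can be used directly. This is the origin of the factor 2/(1 + b) in the
        constant.\<close>
      have "1 - s\<^sup>2 = (1 - s) * (1 + s)" by (simp add: power2_eq_square algebra_simps)
      then have "1 / s - 1 = (1 - s\<^sup>2) / (s * (1 + s))"
        using s by (simp add: diff_divide_distrib)
      also have "\<dots> \<le> 2 * ?L / (b * (1 + b))"
        using s_lower b bs s L0 by (intro frac_le mult_mono) auto
      finally show "1 / s - 1 \<le> 2 * ?L / (b * (1 + b))" .
    qed simp
    ultimately have "normal_dist_error M X n \<le> ?L + C0 / b ^ 3 * (4.25 * (?L + ?N))
       + ?L / (sqrt (2 * pi) * b) + exp (- 1 / 2) / sqrt (2 * pi) * (2 * ?L / (b * (1 + b)))"
      using normal_dist_error_le_of_coupling[of n X Y a, OF X Y sd] be s s1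
      unfolding s_def by fastforce
    also have "\<dots> \<le> ?c2 * (?L + ?N)"
    proof -
      \<comment> \<open>\<open>w\<close> is the joint coefficient of \<open>?L\<close> from the
        shift and the change of scale. The second argument of the maximum is 1 + 4.25 C0/b^3 + w, so
        its product with L + N exceeds the bound just obtained by (1 + w) N >= 0.\<close>
      define w where "w = 1 / (sqrt (2 * pi) * b) * (1 + 2 * exp (- 1 / 2) / (1 + b))"
      have w0: "0 \<le> w" using b by (simp add: w_def)
      have eq: "?L / (sqrt (2 * pi) * b) + exp (- 1 / 2) / sqrt (2 * pi) * (2 * ?L / (b * (1 + b))) = w * ?L"
      proof -
        have "x / (r * b) + e / r * (2 * x / (b * d)) = 1 / (r * b) * (1 + 2 * e / d) * x"
          for x r d e :: real
          by (simp add: divide_inverse distrib_left distrib_right mult_ac)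
        then show ?thesis unfolding w_def .
      qed
      have "0 \<le> (1 + w) * ?N" using w0 N0 by simp
      moreover have "?c2 * (?L + ?N) = ?L + C0 / b ^ 3 * (4.25 * (?L + ?N)) + w * ?L + (1 + w) * ?N"
      proof -
        have "4.25 * C0 / b ^ 3 = 4.25 * (C0 / b ^ 3)" by simp
        moreover have "(1 + 4.25 * q + w) * (x + y) = x + q * (4.25 * (x + y)) + w * x + (1 + w) * y"
          for q x y :: real
          by (simp add: algebra_simps)
        ultimately show ?thesis unfolding w_def[symmetric] by (simp only:)
      qed
      ultimately show ?thesis using eq by linarith
    qed
    also have "\<dots> \<le> max ?c1 ?c2 * (?L + ?N)" using L0 N0 by (intro mult_right_mono) auto
    finally show ?thesis .
  qed
qed

end

section \<open>Reduction to unit variance, and the infimum over b\<close>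

text \<open>Division by \<open>c\<close> scales the standard deviation and both truncation levels
  alike. The sums of truncated second and third moments pick up the factors 1/c^2 and 1/c^3, which
  cancel against the normalising denominators.\<close>

lemma
  fixes c :: real
  assumes c: "0 < c" "c = sum_sd M X n"
  defines "Z \<equiv> \<lambda>k \<omega>. X k \<omega> / c"
  shows sum_sd_normalize: "sum_sd M Z n = 1"
    and normal_dist_error_normalize: "normal_dist_error M Z n = normal_dist_error M X n"
    and lindeberg_fraction_normalize: "lindeberg_fraction M Z n = lindeberg_fraction M X n"
    and truncated_lyapunov_fraction_normalize:
      "truncated_lyapunov_fraction M Z n = truncated_lyapunov_fraction M X n"
proof -
  have "(\<Sum>k=1..n. \<integral>\<omega>. (Z k \<omega>)\<^sup>2 \<partial>M) = (\<Sum>k=1..n. \<integral>\<omega>. (X k \<omega>)\<^sup>2 \<partial>M) / c\<^sup>2"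
    by (simp add: Z_def power_divide sum_divide_distrib)
  then have "sum_sd M Z n = c / c"
    using c by (simp add: sum_sd_def real_sqrt_divide)
  then show sd: "sum_sd M Z n = 1" using c by simp
  have "partial_sum Z n \<omega> < x \<longleftrightarrow> partial_sum X n \<omega> < x * c" for \<omega> x
    using c by (simp add: partial_sum_def Z_def sum_divide_distrib[symmetric] pos_divide_less_eq)
  then show "normal_dist_error M Z n = normal_dist_error M X n"
    by (simp add: normal_dist_error_def sd c(2)[symmetric])
  have "(Z k \<omega>)\<^sup>2 * indicator {y. \<bar>y\<bar> > 1} (Z k \<omega>)
      = 1 / c\<^sup>2 * ((X k \<omega>)\<^sup>2 * indicator {y. \<bar>y\<bar> > c} (X k \<omega>))" for k \<omega>
    using c(1) by (auto simp: Z_def power_divide abs_divide field_simps split: split_indicator)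
  then show "lindeberg_fraction M Z n = lindeberg_fraction M X n"
    by (simp add: lindeberg_fraction_def sd c(2)[symmetric] sum_divide_distrib)
  have "\<bar>Z k \<omega>\<bar> ^ 3 * indicator {y. \<bar>y\<bar> \<le> 1} (Z k \<omega>)
      = 1 / c ^ 3 * (\<bar>X k \<omega>\<bar> ^ 3 * indicator {y. \<bar>y\<bar> \<le> c} (X k \<omega>))" for k \<omega>
    using c(1) by (auto simp: Z_def power_divide abs_divide field_simps split: split_indicator)
  then show "truncated_lyapunov_fraction M Z n = truncated_lyapunov_fraction M X n"
    by (simp add: truncated_lyapunov_fraction_def sd c(2)[symmetric] sum_divide_distrib)
qed

text \<open>For r > 0 the number x/r is a lower bound of all \<open>f i\<close>, hence of their
  infimum. The case r = 0 is split off because division is lost; there any index gives x <=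
  0.\<close>

lemma le_cINF_mult_right:
  fixes f :: "'b \<Rightarrow> real"
  assumes "I \<noteq> {}" "0 \<le> r" and le: "\<And>i. i \<in> I \<Longrightarrow> x \<le> f i * r"
  shows "x \<le> (INF i\<in>I. f i) * r"
proof (cases "r = 0")
  case True
  then show ?thesis using assms by auto
next
  case False
  with \<open>0 \<le> r\<close> have "0 < r" by simp
  then have "x / r \<le> (INF i\<in>I. f i)"
    using assms by (intro cINF_greatest) (auto simp: pos_divide_le_eq)
  then show ?thesis using \<open>0 < r\<close> by (simp add: pos_divide_le_eq)
qed

theorem mainTheorem6:
  fixes M :: "'a measure" and X :: "nat \<Rightarrow> 'a \<Rightarrow> real" and n :: nat and C0 :: real
  assumes "prob_space M"
    and "prob_space.indep_vars M (\<lambda>_. borel) X {1..n}"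
    and "\<And>k. k \<in> {1..n} \<Longrightarrow> (\<integral>\<omega>. X k \<omega> \<partial>M) = 0"
    and "\<And>k. k \<in> {1..n} \<Longrightarrow> integrable M (\<lambda>\<omega>. (X k \<omega>)\<^sup>2)"
    and "0 < (\<Sum>k=1..n. \<integral>\<omega>. (X k \<omega>)\<^sup>2 \<partial>M)"
    and "berry_esseen_const C0"
  shows "normal_dist_error M X n
    \<le> (INF b\<in>{0<..<1}.
          max (2 / (1 - b\<^sup>2))
              (1 + 4.25 * C0 / b ^ 3
                 + 1 / (sqrt (2 * pi) * b) * (1 + 2 * exp (- 1 / 2) / (1 + b))))
      * (lindeberg_fraction M X n + truncated_lyapunov_fraction M X n)"
proof -
  interpret prob_space M by fact
  define c where "c = sum_sd M X n"
  define Z where "Z = (\<lambda>k \<omega>. X k \<omega> / c)"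
  have c: "0 < c" using assms(5) by (simp add: c_def sum_sd_def)
  note norm = sum_sd_normalize[OF c c_def, folded Z_def]
    normal_dist_error_normalize[OF c c_def, folded Z_def]
    lindeberg_fraction_normalize[OF c c_def, folded Z_def]
    truncated_lyapunov_fraction_normalize[OF c c_def, folded Z_def]
  have "indep_vars (\<lambda>_. borel) Z {1..n}"
    unfolding Z_def using assms(2) by (rule indep_vars_compose2[where Y="\<lambda>_ x. x / c"]) simp
  moreover have "expectation (Z k) = 0" if "k \<in> {1..n}" for k
    using assms(3)[OF that] by (simp add: Z_def)
  moreover have "integrable M (\<lambda>\<omega>. (Z k \<omega>)\<^sup>2)" if "k \<in> {1..n}" for k
    using assms(4)[OF that] by (simp add: Z_def power_divide)
  ultimately have "normal_dist_error M X n
    \<le> max (2 / (1 - b\<^sup>2))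
          (1 + 4.25 * C0 / b ^ 3 + 1 / (sqrt (2 * pi) * b) * (1 + 2 * exp (- 1 / 2) / (1 + b)))
      * (lindeberg_fraction M X n + truncated_lyapunov_fraction M X n)" if "b \<in> {0<..<1}" for b
    using normal_dist_error_le_normalized[of Z n C0 b] norm assms(6) that by simp
  \<comment> \<open>The bound now holds for each b in (0, 1) with the same factor on the right; its
    nonnegativity lets the infimum be taken over the constants alone.\<close>
  moreover have "0 \<le> lindeberg_fraction M X n + truncated_lyapunov_fraction M X n"
    unfolding lindeberg_fraction_def truncated_lyapunov_fraction_def using c unfolding c_def
    by (intro add_nonneg_nonneg mult_nonneg_nonneg sum_nonneg
        Bochner_Integration.integral_nonneg) auto
  ultimately show ?thesis by (intro le_cINF_mult_right) auto
qed

end
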